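(* Let $e=xy$ be an edge of a tree $T$. Then: (i) $\gamma_{ri2}(T)\le\gamma_{ri2}(T-e)\le\gamma_{ri2}(T)+1$. (ii) $\gamma_{ri2}(T-e)=\gamma_{ri2}(T)+1$ if and only if for each $\gamma_{ri2}$-function $f=(V_0;V_1;V_2)$ on $T$, exactly one of $x$ and $y$ is in $V_0$ and this one has exactly $2$ neighbors (in $T$) in $V_1\cup V_2$.
   Context: All graphs are finite, without loops or multiple edges. A 2-rainbow independent dominating function (2RiDF) of a graph $G$ is a function $f:V(G)\to\{0,1,2\}$ such that, writing $V_i=\{x\in V(G): f(x)=i\}$, the sets $V_1$ and $V_2$ are each independent and every vertex $u$ with $f(u)=0$ is adjacent to at least one vertex of $V_1$ and at least one vertex of $V_2$. One also writes $f=(V_0;V_1;V_2)$. Its weight is $w(f)=|V_1|+|V_2|$. The 2-rainbow independent domination number $\gamma_{ri2}(G)$ is the minimum weight of a 2RiDF of $G$; a $\gamma_{ri2}$-function on $G$ is a 2RiDF of $G$ of weight $\gamma_{ri2}(G)$. $T-e$ is the graph obtained from $T$ by deleting the edge $e$ (keeping all vertices). *)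

theory Defs
  imports "Graph_Theory.Graph_Theory"
begin

text \<open>
  A finite simple graph is a \<open>pair_graph\<close>: a finite, symmetric, loop-free relation
  \<open>parcs G\<close> on \<open>pverts G\<close>. The edge \<open>xy\<close> is the pair of arcs \<open>(x, y)\<close>, \<open>(y, x)\<close>.
\<close>

text \<open>
  The constants \<open>forest\<close> and \<open>tree\<close> of \<open>Graph_Theory\<close> are meant for directed graphs: they
  regard traversing an edge back and forth as a cycle, so that no symmetric graph with an edge
  is a \<open>tree\<close>. In a symmetric graph without loops or multiple edges, the cycles of length at
  least 3 are exactly the cycles of the undirected graph.
\<close>

definition undirected_tree :: "'a pair_pre_digraph \<Rightarrow> bool" where
  "undirected_tree G \<longleftrightarrow> pair_graph G \<and> connected (with_proj G) \<and>
     \<not> (\<exists>p. pre_digraph.cycle (with_proj G) p \<and> 3 \<le> length p)"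

definition delete_edge :: "'a pair_pre_digraph \<Rightarrow> 'a \<Rightarrow> 'a \<Rightarrow> 'a pair_pre_digraph" where
  "delete_edge G x y = \<lparr>pverts = pverts G, parcs = parcs G - {(x, y), (y, x)}\<rparr>"

definition neighbors :: "'a pair_pre_digraph \<Rightarrow> 'a \<Rightarrow> 'a set" where
  "neighbors G u = {v. (u, v) \<in> parcs G}"

definition independent_vertices :: "'a pair_pre_digraph \<Rightarrow> 'a set \<Rightarrow> bool" where
  "independent_vertices G S \<longleftrightarrow> S \<subseteq> pverts G \<and> (\<forall>u\<in>S. \<forall>v\<in>S. (u, v) \<notin> parcs G)"

definition color_class :: "'a pair_pre_digraph \<Rightarrow> ('a \<Rightarrow> nat) \<Rightarrow> nat \<Rightarrow> 'a set" where
  "color_class G f i = {u \<in> pverts G. f u = i}"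

text \<open>The values of \<open>f\<close> outside \<open>pverts G\<close> are irrelevant in all notions below.\<close>

definition is_2RiDF :: "'a pair_pre_digraph \<Rightarrow> ('a \<Rightarrow> nat) \<Rightarrow> bool" where
  "is_2RiDF G f \<longleftrightarrow> f \<in> pverts G \<rightarrow> {0, 1, 2} \<and>
     independent_vertices G (color_class G f 1) \<and>
     independent_vertices G (color_class G f 2) \<and>
     (\<forall>u \<in> color_class G f 0.
        neighbors G u \<inter> color_class G f 1 \<noteq> {} \<and>
        neighbors G u \<inter> color_class G f 2 \<noteq> {})"

definition weight :: "'a pair_pre_digraph \<Rightarrow> ('a \<Rightarrow> nat) \<Rightarrow> nat" where
  "weight G f = card (color_class G f 1) + card (color_class G f 2)"

definition gamma_ri2 :: "'a pair_pre_digraph \<Rightarrow> nat" where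
  "gamma_ri2 G = (LEAST n. \<exists>f. is_2RiDF G f \<and> weight G f = n)"

definition is_gamma_ri2_function :: "'a pair_pre_digraph \<Rightarrow> ('a \<Rightarrow> nat) \<Rightarrow> bool" where
  "is_gamma_ri2_function G f \<longleftrightarrow> is_2RiDF G f \<and> weight G f = gamma_ri2 G"

lemma pair_graph_delete_edge:
  assumes "pair_graph G"
  shows "pair_graph (delete_edge G x y)"
proof -
  interpret pair_graph G by (rule assms)
  have s: "(v, u) \<in> parcs G" if "(u, v) \<in> parcs G" for u v
    using pair_sym_arcs that unfolding symmetric_def sym_def by simp
  show ?thesis
  proof
    show "symmetric (with_proj (delete_edge G x y))"
      unfolding symmetric_def sym_def delete_edge_def by (simp, blast intro: s)
    show "finite (pverts (delete_edge G x y))" "finite (parcs (delete_edge G x y))"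
      unfolding delete_edge_def using pair_finite_verts pair_finite_arcs by simp_all
    fix e assume "e \<in> parcs (delete_edge G x y)"
    then have e: "e \<in> parcs G" by (simp add: delete_edge_def)
    show "fst e \<in> pverts (delete_edge G x y)" "snd e \<in> pverts (delete_edge G x y)"
      unfolding delete_edge_def using arc_fst_in_verts[OF e] arc_snd_in_verts[OF e] by simp_all
    show "fst e \<noteq> snd e" by (rule pair_no_loops[OF e])
  qed
qed

lemma ex_maximal_independent:
  assumes "pair_graph G" "A \<subseteq> pverts G"
  shows "\<exists>S. S \<subseteq> A \<and> independent_vertices G S \<and> (\<forall>u\<in>A - S. neighbors G u \<inter> S \<noteq> {})"
proof -
  interpret pair_graph G by (rule assms)
  have s: "(u, v) \<in> parcs G \<Longrightarrow> (v, u) \<in> parcs G" for u v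
    using pair_sym_arcs unfolding symmetric_def sym_def by simp
  have l: "(u, u) \<notin> parcs G" for u using pair_no_loops by fastforce
  have "finite A" using assms(2) pair_finite_verts finite_subset by blast
  let ?F = "{S. S \<subseteq> A \<and> independent_vertices G S}"
  have "finite ?F" using \<open>finite A\<close> by simp
  moreover have "?F \<noteq> {}" by (auto simp: independent_vertices_def)
  ultimately have "\<exists>S\<in>?F. \<forall>R\<in>?F. S \<subseteq> R \<longrightarrow> S = R"
    by (rule finite_has_maximal)
  then obtain S where S: "S \<in> ?F" and m: "\<forall>R\<in>?F. S \<subseteq> R \<longrightarrow> S = R"
    by (rule bexE)
  have "neighbors G u \<inter> S \<noteq> {}" if u: "u \<in> A - S" for u
  proof
    assume e: "neighbors G u \<inter> S = {}"
    have n: "(u, v) \<notin> parcs G" "(v, u) \<notin> parcs G" if "v \<in> S" for v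
      using e s[of v u] that unfolding neighbors_def by blast+
    have "insert u S \<in> ?F"
      using S u l n assms(2) unfolding independent_vertices_def by blast
    with m have "S = insert u S" by (meson subset_insertI)
    with u show False by blast
  qed
  with S show ?thesis by blast
qed

text \<open>The minimum defining \<open>gamma_ri2\<close> is taken over a nonempty set.\<close>

lemma ex_2RiDF:
  assumes "pair_graph G"
  shows "\<exists>f. is_2RiDF G f"
proof -
  obtain S1 where 1: "S1 \<subseteq> pverts G" "independent_vertices G S1"
    "\<forall>u\<in>pverts G - S1. neighbors G u \<inter> S1 \<noteq> {}"
    using ex_maximal_independent[OF assms, of "pverts G"] by blast
  obtain S2 where 2: "S2 \<subseteq> pverts G - S1" "independent_vertices G S2"
    "\<forall>u\<in>pverts G - S1 - S2. neighbors G u \<inter> S2 \<noteq> {}"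
    using ex_maximal_independent[OF assms, of "pverts G - S1"] by blast
  define f where "f u = (if u \<in> S1 then 1 else if u \<in> S2 then 2 else 0 :: nat)" for u
  have c: "color_class G f 1 = S1" "color_class G f 2 = S2"
    "color_class G f 0 = pverts G - S1 - S2"
    using 1(1) 2(1) by (auto simp: color_class_def f_def split: if_splits)
  have "is_2RiDF G f"
    unfolding is_2RiDF_def c using 1(2,3) 2(2,3) by (simp add: f_def)
  then show ?thesis by blast
qed

end

theory Submission
  imports Defs
begin

text \<open>
  Deleting \<open>xy\<close> splits the tree into two parts, and exchanging the colors 1 and 2 on the part
  of \<open>y\<close> preserves the 2RiDFs of \<open>T - xy\<close>; so some minimum 2RiDF of \<open>T - xy\<close> is
  one of \<open>T\<close>. Conversely, a 2RiDF of \<open>T\<close> fails on \<open>T - xy\<close> only if, up to symmetry,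
  \<open>x\<close> has color 0 and \<open>y\<close> is its only neighbor of color \<open>f y \<noteq> 0\<close>; recoloring \<open>x\<close>
  with \<open>f y\<close> then costs 1. If in addition \<open>x\<close> has two neighbors \<open>z\<close>, \<open>z'\<close> of the other
  color, exchanging the colors on the part of \<open>z\<close> in \<open>T - xz\<close> gives \<open>x\<close> a second neighbor
  of color \<open>f y\<close>, and the result is a 2RiDF of \<open>T - xy\<close> of the same weight.
\<close>

section \<open>Edge deletion, and 2RiDFs in pointwise form\<close>

lemma pverts_delete_edge [simp]: "pverts (delete_edge G x y) = pverts G"
  and parcs_delete_edge [simp]: "parcs (delete_edge G x y) = parcs G - {(x, y), (y, x)}"
  by (simp_all add: delete_edge_def)

lemma delete_edge_commute: "delete_edge G x y = delete_edge G y x"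
  by (simp add: delete_edge_def insert_commute)

lemma color_class_delete_edge [simp]: "color_class (delete_edge G x y) f i = color_class G f i"
  by (simp add: color_class_def)

lemma weight_delete_edge [simp]: "weight (delete_edge G x y) f = weight G f"
  by (simp add: weight_def)

lemma pair_graph_arcD:
  assumes "pair_graph G" "(u, v) \<in> parcs G"
  shows "u \<in> pverts G" "v \<in> pverts G" "(v, u) \<in> parcs G" "u \<noteq> v"
proof -
  interpret pair_graph G by (rule assms(1))
  show "u \<in> pverts G" "v \<in> pverts G"
    using arc_fst_in_verts[OF assms(2)] arc_snd_in_verts[OF assms(2)] by simp_all
  show "(v, u) \<in> parcs G"
    using pair_sym_arcs assms(2) unfolding symmetric_def sym_def by simp
  show "u \<noteq> v" using pair_no_loops[OF assms(2)] by simp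
qed

lemma pair_graph_finite_pverts: "pair_graph G \<Longrightarrow> finite (pverts G)"
  by (simp add: pair_graph_def pair_digraph_def pair_fin_digraph.pair_finite_verts)

text \<open>Once the colors lie in \<open>{0, 1, 2}\<close>, independence of both classes amounts to
  one condition on arcs. This arcwise form makes the effect of changing a single edge
  visible.\<close>

lemma is_2RiDF_iff:
  assumes "pair_graph G"
  shows "is_2RiDF G f \<longleftrightarrow>
    (\<forall>u\<in>pverts G. f u \<in> {0, 1, 2}) \<and>
    (\<forall>u v. (u, v) \<in> parcs G \<longrightarrow> f u = f v \<longrightarrow> f u = 0) \<and>
    (\<forall>u\<in>pverts G. f u = 0 \<longrightarrow> (\<forall>c\<in>{1, 2}. \<exists>v. (u, v) \<in> parcs G \<and> f v = c))"
    (is "_ \<longleftrightarrow> ?range \<and> ?indep \<and> ?dom")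
proof -
  note v = pair_graph_arcD(1,2)[OF assms]
  have dom: "?dom \<longleftrightarrow> (\<forall>u \<in> color_class G f 0.
        neighbors G u \<inter> color_class G f 1 \<noteq> {} \<and> neighbors G u \<inter> color_class G f 2 \<noteq> {})"
    using v(2) by (fastforce simp: color_class_def neighbors_def)
  have indep: "?indep \<longleftrightarrow> independent_vertices G (color_class G f 1) \<and>
      independent_vertices G (color_class G f 2)" if r: ?range
  proof
    assume ?indep
    then show "independent_vertices G (color_class G f 1) \<and>
      independent_vertices G (color_class G f 2)"
      by (fastforce simp: independent_vertices_def color_class_def)
  next
    assume i: "independent_vertices G (color_class G f 1) \<and>
      independent_vertices G (color_class G f 2)"
    show ?indep
    proof (intro allI impI)
      fix u w assume a: "(u, w) \<in> parcs G" and e: "f u = f w"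
      have "f u \<in> {0, 1, 2}" using r v[OF a] by blast
      then show "f u = 0"
        using i a e v[OF a] by (auto simp: independent_vertices_def color_class_def)
    qed
  qed
  show ?thesis unfolding is_2RiDF_def Pi_iff using dom indep by blast
qed

text \<open>The weight depends only on the support, so exchanging colors preserves it and recoloring
  one vertex of color 0 raises it by 1.\<close>

lemma weight_eq_card_nonzero:
  assumes "pair_graph G" "is_2RiDF G f"
  shows "weight G f = card {u \<in> pverts G. f u \<noteq> 0}"
proof -
  have "{u \<in> pverts G. f u \<noteq> 0} = color_class G f 1 \<union> color_class G f 2"
    using assms(2) unfolding is_2RiDF_def Pi_iff color_class_def by auto
  moreover have "color_class G f 1 \<inter> color_class G f 2 = {}"
    by (auto simp: color_class_def)
  ultimately show ?thesis
    using pair_graph_finite_pverts[OF assms(1)] by (simp add: weight_def card_Un_disjoint color_class_def)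
qed

lemma gamma_ri2_le: "is_2RiDF G f \<Longrightarrow> gamma_ri2 G \<le> weight G f"
  unfolding gamma_ri2_def by (rule Least_le) blast

lemma ex_gamma_ri2_function:
  assumes "pair_graph G"
  shows "\<exists>f. is_gamma_ri2_function G f"
  unfolding is_gamma_ri2_function_def gamma_ri2_def
  by (rule LeastI_ex) (use ex_2RiDF[OF assms] in blast)

section \<open>Color exchange on one side of a bridge\<close>

text \<open>Subtraction from 3 exchanges 1 and 2; the guard \<open>f u \<noteq> 0\<close> keeps the
  color 0 fixed.\<close>

definition swap_colors :: "'a set \<Rightarrow> ('a \<Rightarrow> nat) \<Rightarrow> 'a \<Rightarrow> nat" where
  "swap_colors C f u = (if u \<in> C \<and> f u \<noteq> 0 then 3 - f u else f u)"

text \<open>No arc leaves \<open>C\<close>, so the colors at the two ends of an arc are either both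
  exchanged or both kept.\<close>

lemma swap_colors_2RiDF:
  assumes G: "pair_graph G" and f: "is_2RiDF G f"
    and C: "\<And>u v. (u, v) \<in> parcs G \<Longrightarrow> u \<in> C \<longleftrightarrow> v \<in> C"
  shows "is_2RiDF G (swap_colors C f)" "weight G (swap_colors C f) = weight G f"
proof -
  let ?g = "swap_colors C f"
  note f' = f[unfolded is_2RiDF_iff[OF G]]
  have r: "f u = 0 \<or> f u = 1 \<or> f u = 2" if "u \<in> pverts G" for u
    using f' that by blast
  have z: "?g u = 0 \<longleftrightarrow> f u = 0" if "u \<in> pverts G" for u
    using r[OF that] by (auto simp: swap_colors_def)
  show g: "is_2RiDF G ?g"
    unfolding is_2RiDF_iff[OF G]
  proof (intro conjI ballI allI impI)
    show "?g u \<in> {0, 1, 2}" if "u \<in> pverts G" for u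
      using r[OF that] by (auto simp: swap_colors_def)
  next
    fix u v assume a: "(u, v) \<in> parcs G" and e: "?g u = ?g v"
    have "f u = f v"
      using e C[OF a] r[OF pair_graph_arcD(1)[OF G a]] r[OF pair_graph_arcD(2)[OF G a]]
      by (auto simp: swap_colors_def split: if_splits)
    then have "f u = 0" using f' a by blast
    then show "?g u = 0" by (simp add: swap_colors_def)
  next
    fix u and c :: nat assume u: "u \<in> pverts G" "?g u = 0" and c: "c \<in> {1, 2}"
    have "f u = 0" using z u by blast
    \<comment> \<open>A vertex of \<open>C\<close> sees the color \<open>c\<close> after the
      exchange if it saw \<open>3 - c\<close> before.\<close>
    moreover have "(if u \<in> C then 3 - c else c) \<in> {1, 2}" using c by auto
    ultimately obtain v where v: "(u, v) \<in> parcs G" "f v = (if u \<in> C then 3 - c else c)"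
      using f' u(1) by blast
    then have "?g v = c" using C[OF v(1)] c by (auto simp: swap_colors_def)
    with v show "\<exists>v. (u, v) \<in> parcs G \<and> ?g v = c" by blast
  qed
  have "{u \<in> pverts G. ?g u \<noteq> 0} = {u \<in> pverts G. f u \<noteq> 0}" by (simp add: z cong: conj_cong)
  then show "weight G ?g = weight G f"
    by (simp add: weight_eq_card_nonzero[OF G f] weight_eq_card_nonzero[OF G g])
qed

lemma undirected_tree_bridge:
  assumes T: "undirected_tree T" and xy: "(x, y) \<in> parcs T"
  obtains C where "y \<in> C" "x \<notin> C"
    "\<And>u v. (u, v) \<in> parcs (delete_edge T x y) \<Longrightarrow> u \<in> C \<longleftrightarrow> v \<in> C"
proof -
  let ?D = "delete_edge T x y"
  have G: "pair_graph T" using T by (simp add: undirected_tree_def)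
  have D: "pair_graph ?D" by (rule pair_graph_delete_edge[OF G])
  interpret G: pair_graph T by (rule G)
  interpret D: pair_graph ?D by (rule D)
  \<comment> \<open>The component of \<open>y\<close> after the deletion. A path in it from
    \<open>y\<close> to \<open>x\<close> would close up with the arc \<open>(x, y)\<close> to a
    cycle of \<open>T\<close>.\<close>
  let ?C = "{v. y \<rightarrow>\<^sup>*\<^bsub>with_proj ?D\<^esub> v}"
  have yv: "y \<in> pverts T" and xney: "x \<noteq> y" using pair_graph_arcD[OF G xy] by simp_all
  show thesis
  proof
    show "y \<in> ?C" using yv by (simp add: D.reachable_refl)
  next
    show "x \<notin> ?C"
    proof
      assume "x \<in> ?C"
      then obtain p where p: "D.apath y p x" by (auto simp: D.reachable_apath)
      then have w: "D.awalk y p x" and d: "distinct (D.awalk_verts y p)"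
        by (simp_all add: D.apath_def)
      have "subgraph (with_proj ?D) (with_proj T)"
        using D.wf_digraph G.wf_digraph
        by (auto simp: subgraph_def compatible_def)
      from G.subgraph_awalk_imp_awalk[OF w this] have wG: "G.awalk y p x" .
      have "G.awalk x ((x, y) # p) x"
        using wG xy by (simp add: G.awalk_Cons_iff)
      then have "G.cycle ((x, y) # p)"
        using d by (auto simp: G.cycle_def)
      \<comment> \<open>The path \<open>p\<close> is nonempty because \<open>x \<noteq> y\<close>,
        and it is not a single arc because \<open>(y, x)\<close> has been deleted.\<close>
      moreover have "3 \<le> length ((x, y) # p)"
      proof -
        have "p \<noteq> []" using w xney by (auto simp: D.awalk_Nil_iff)
        moreover have "p \<noteq> [e]" for e
          using w by (auto simp: D.awalk_Cons_iff D.awalk_Nil_iff)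
        ultimately show ?thesis by (cases p; cases "tl p") auto
      qed
      ultimately show False using T unfolding undirected_tree_def by blast
    qed
  next
    fix u v assume a: "(u, v) \<in> parcs ?D"
    note s = pair_graph_arcD(3)[OF D a]
    have "u \<rightarrow>\<^bsub>with_proj ?D\<^esub> v" "v \<rightarrow>\<^bsub>with_proj ?D\<^esub> u" using a s by simp_all
    then show "u \<in> ?C \<longleftrightarrow> v \<in> ?C" by (auto intro: D.reachable_adj_trans)
  qed
qed

section \<open>2RiDFs under insertion and deletion of an edge\<close>

text \<open>A new edge cannot harm domination, and independence has to be checked anew only at its
  own ends.\<close>

lemma is_2RiDF_insert_edge:
  assumes G: "pair_graph G" and f: "is_2RiDF (delete_edge G x y) f"
    and "f x = f y \<Longrightarrow> f x = 0"
  shows "is_2RiDF G f"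
proof -
  note f' = f[unfolded is_2RiDF_iff[OF pair_graph_delete_edge[OF G]]]
  show ?thesis
    unfolding is_2RiDF_iff[OF G]
  proof (intro conjI ballI allI impI)
    fix u v assume "(u, v) \<in> parcs G" "f u = f v"
    then show "f u = 0" using f' assms(3) by fastforce
  qed (use f' in fastforce)+
qed

text \<open>Only an end of color 0 can lose a dominating neighbor, namely the other end; the
  hypotheses supply a replacement.\<close>

lemma is_2RiDF_delete_edge:
  assumes G: "pair_graph G" and f: "is_2RiDF G f"
    and x: "f x = 0 \<Longrightarrow> f y \<noteq> 0 \<Longrightarrow> \<exists>z. z \<noteq> y \<and> (x, z) \<in> parcs G \<and> f z = f y"
    and y: "f y = 0 \<Longrightarrow> f x \<noteq> 0 \<Longrightarrow> \<exists>z. z \<noteq> x \<and> (y, z) \<in> parcs G \<and> f z = f x"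
  shows "is_2RiDF (delete_edge G x y) f"
proof -
  note f' = f[unfolded is_2RiDF_iff[OF G]]
  show ?thesis
    unfolding is_2RiDF_iff[OF pair_graph_delete_edge[OF G]]
  proof (intro conjI ballI allI impI)
    fix u and c :: nat assume u: "u \<in> pverts (delete_edge G x y)" "f u = 0" and c: "c \<in> {1, 2}"
    then obtain v where v: "(u, v) \<in> parcs G" "f v = c" using f' by fastforce
    have uv: "u \<noteq> v" using pair_graph_arcD(4)[OF G v(1)] .
    have c0: "c \<noteq> 0" using c by auto
    consider "u = x" "v = y" | "u = y" "v = x" | "(u, v) \<in> parcs (delete_edge G x y)"
      using v(1) by auto
    then show "\<exists>v. (u, v) \<in> parcs (delete_edge G x y) \<and> f v = c"
    proof cases
      case 1
      then obtain z where "z \<noteq> y" "(x, z) \<in> parcs G" "f z = c" using x u v c0 by auto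
      then show ?thesis using 1 uv by auto
    next
      case 2
      then obtain z where "z \<noteq> x" "(y, z) \<in> parcs G" "f z = c" using y u v c0 by auto
      then show ?thesis using 2 uv by auto
    next
      case 3
      then show ?thesis using v(2) by blast
    qed
  qed (use f' in auto)
qed

text \<open>Once \<open>xy\<close> is gone, \<open>x\<close> has no neighbor of color
  \<open>f y\<close>, so it may take this color. Having had color 0, it dominated no other
  vertex.\<close>

lemma is_2RiDF_recolor_endpoint:
  assumes G: "pair_graph G" and xy: "(x, y) \<in> parcs G" and f: "is_2RiDF G f"
    and x0: "f x = 0" and y0: "f y \<noteq> 0"
    and only: "\<And>z. (x, z) \<in> parcs G \<Longrightarrow> f z = f y \<Longrightarrow> z = y"
  shows "is_2RiDF (delete_edge G x y) (f(x := f y))" "weight G (f(x := f y)) = weight G f + 1"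
proof -
  let ?D = "delete_edge G x y" and ?g = "f(x := f y)"
  note D = pair_graph_delete_edge[OF G]
  note f' = f[unfolded is_2RiDF_iff[OF G]]
  note xv = pair_graph_arcD[OF G xy]
  show g: "is_2RiDF ?D ?g"
    unfolding is_2RiDF_iff[OF D]
  proof (intro conjI ballI allI impI)
    show "?g u \<in> {0, 1, 2}" if "u \<in> pverts ?D" for u
      using f' that xv by auto
  next
    fix u v assume a: "(u, v) \<in> parcs ?D" and e: "?g u = ?g v"
    have a': "(u, v) \<in> parcs G" "(v, u) \<in> parcs G" "u \<noteq> v"
      using a pair_graph_arcD[OF G] by auto
    consider "u = x" | "v = x" | "u \<noteq> x" "v \<noteq> x" by blast
    then show "?g u = 0"
    proof cases
      case 1
      then show ?thesis using only[of v] a a' e by auto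
    next
      case 2
      then show ?thesis using only[of u] a a' e by auto
    next
      case 3
      then show ?thesis using f' a' e by auto
    qed
  next
    fix u and c :: nat assume u: "u \<in> pverts ?D" "?g u = 0" and c: "c \<in> {1, 2}"
    have ux: "u \<noteq> x" and fu: "f u = 0" using u y0 by (auto split: if_splits)
    then obtain v where v: "(u, v) \<in> parcs G" "f v = c" using f' u c by fastforce
    then have "v \<noteq> x" using c x0 by auto
    then show "\<exists>v. (u, v) \<in> parcs ?D \<and> ?g v = c" using v ux by auto
  qed
  have "{u \<in> pverts G. ?g u \<noteq> 0} = insert x {u \<in> pverts G. f u \<noteq> 0}" using xv y0 by auto
  moreover have "finite {u \<in> pverts G. f u \<noteq> 0}"
    using pair_graph_finite_pverts[OF G] by simp
  ultimately show "weight G ?g = weight G f + 1"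
    using weight_eq_card_nonzero[OF D g] weight_eq_card_nonzero[OF G f] x0 by simp
qed

section \<open>Comparing the minimum weights before and after the deletion\<close>

lemma gamma_ri2_delete_edge_le:
  assumes G: "pair_graph G" and xy: "(x, y) \<in> parcs G"
  shows "gamma_ri2 (delete_edge G x y) \<le> gamma_ri2 G + 1"
proof -
  obtain f where f: "is_2RiDF G f" "weight G f = gamma_ri2 G"
    using ex_gamma_ri2_function[OF G] by (auto simp: is_gamma_ri2_function_def)
  note yx = pair_graph_arcD(3)[OF G xy]
  have "\<exists>g. is_2RiDF (delete_edge G x y) g \<and> weight G g \<le> weight G f + 1"
  proof (cases "is_2RiDF (delete_edge G x y) f")
    case False
    \<comment> \<open>A failed replacement condition of \<open>is_2RiDF_delete_edge\<close> is what
      allows recoloring that end.\<close>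
    then consider "f x = 0" "f y \<noteq> 0" "\<And>z. (x, z) \<in> parcs G \<Longrightarrow> f z = f y \<Longrightarrow> z = y"
      | "f y = 0" "f x \<noteq> 0" "\<And>z. (y, z) \<in> parcs G \<Longrightarrow> f z = f x \<Longrightarrow> z = x"
      using is_2RiDF_delete_edge[OF G f(1), of x y] by metis
    then show ?thesis
    proof cases
      case 1
      then show ?thesis
        by (intro exI[of _ "f(x := f y)"]) (simp add: is_2RiDF_recolor_endpoint[OF G xy f(1)])
    next
      case 2
      then show ?thesis
        unfolding delete_edge_commute[of G x y]
        by (intro exI[of _ "f(y := f x)"]) (simp add: is_2RiDF_recolor_endpoint[OF G yx f(1)])
    qed
  qed auto
  then show ?thesis using f(2) gamma_ri2_le by (metis le_trans weight_delete_edge)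
qed

text \<open>The only obstruction is a common nonzero color of \<open>x\<close> and \<open>y\<close>,
  which the exchange on the part of \<open>y\<close> removes. Besides the lower bound, this supplies
  the witness for the converse of (ii).\<close>

lemma ex_common_2RiDF:
  assumes T: "undirected_tree T" and xy: "(x, y) \<in> parcs T"
    and f: "is_2RiDF (delete_edge T x y) f"
  shows "\<exists>g. is_2RiDF (delete_edge T x y) g \<and> is_2RiDF T g \<and> weight T g = weight T f"
proof (cases "f x = f y \<and> f x \<noteq> 0")
  case True
  have G: "pair_graph T" using T by (simp add: undirected_tree_def)
  note D = pair_graph_delete_edge[OF G]
  obtain C where C: "y \<in> C" "x \<notin> C"
    "\<And>u v. (u, v) \<in> parcs (delete_edge T x y) \<Longrightarrow> u \<in> C \<longleftrightarrow> v \<in> C"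
    using undirected_tree_bridge[OF T xy] by blast
  note g = swap_colors_2RiDF[OF D f C(3), simplified weight_delete_edge]
  \<comment> \<open>Equality would mean \<open>f y = 3 - f y\<close>, impossible by parity.\<close>
  have "swap_colors C f x \<noteq> swap_colors C f y"
    using True C(1,2) by (simp add: swap_colors_def) presburger
  then show ?thesis using g is_2RiDF_insert_edge[OF G g(1)] by blast
next
  case False
  have "pair_graph T" using T by (simp add: undirected_tree_def)
  then show ?thesis using is_2RiDF_insert_edge[OF _ f] f False by blast
qed

text \<open>If no other neighbor of \<open>x\<close> shares the color of \<open>y\<close>, a count
  other than 2 forces two neighbors of the opposite color, one of which can be turned into a
  substitute for \<open>y\<close>.\<close>

lemma ex_gamma_ri2_function_delete_edge:
  assumes T: "undirected_tree T" and xy: "(x, y) \<in> parcs T"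
    and f: "is_gamma_ri2_function T f" and x0: "f x = 0" and y0: "f y \<noteq> 0"
    and card: "card (neighbors T x \<inter> (color_class T f 1 \<union> color_class T f 2)) \<noteq> 2"
  shows "\<exists>g. is_gamma_ri2_function T g \<and> is_2RiDF (delete_edge T x y) g"
proof (cases "\<exists>z. z \<noteq> y \<and> (x, z) \<in> parcs T \<and> f z = f y")
  case True
  have "pair_graph T" using T by (simp add: undirected_tree_def)
  then show ?thesis
    using is_2RiDF_delete_edge[of T f x y] f True x0 y0 unfolding is_gamma_ri2_function_def by blast
next
  case False
  have G: "pair_graph T" using T by (simp add: undirected_tree_def)
  have fT: "is_2RiDF T f" using f by (simp add: is_gamma_ri2_function_def)
  note f' = fT[unfolded is_2RiDF_iff[OF G]]
  note v = pair_graph_arcD[OF G xy]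
  have "f y \<in> {0, 1, 2}" using f' v(2) by blast
  then have fy: "f y = 1 \<or> f y = 2" using y0 by simp
  let ?c = "3 - f y" and ?N = "neighbors T x \<inter> (color_class T f 1 \<union> color_class T f 2)"
  have c: "?c \<in> {1, 2}" "?c \<noteq> f y" using fy by auto
  obtain z where z: "(x, z) \<in> parcs T" "f z = ?c" using f' v(1) x0 c(1) by blast
  have zy: "z \<noteq> y" using z c by auto
  \<comment> \<open>Here \<open>y\<close> is the only neighbor of \<open>x\<close> with color
    \<open>f y\<close>, so the other colored neighbors all have color \<open>?c\<close>.\<close>
  have N: "w \<in> ?N \<longleftrightarrow> (x, w) \<in> parcs T \<and> (w = y \<or> f w = ?c)" for w
    using fy False xy pair_graph_arcD(2)[OF G, of x w]
    by (auto simp: neighbors_def color_class_def)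
  have "\<exists>z'. z' \<noteq> z \<and> (x, z') \<in> parcs T \<and> f z' = ?c"
  proof (rule ccontr)
    assume n: "\<not> ?thesis"
    have "?N = {y, z}" using N n z xy by blast
    then show False using card zy by simp
  qed
  then obtain z' where z': "z' \<noteq> z" "(x, z') \<in> parcs T" "f z' = ?c" by blast
  let ?D = "delete_edge T x z"
  \<comment> \<open>The vertex \<open>z'\<close> still gives \<open>x\<close> the color
    \<open>?c\<close> when \<open>z\<close> is cut off.\<close>
  have fD: "is_2RiDF ?D f"
    by (rule is_2RiDF_delete_edge[OF G fT]) (use z z' x0 c in auto)
  obtain C where C: "z \<in> C" "x \<notin> C" "\<And>u w. (u, w) \<in> parcs ?D \<Longrightarrow> u \<in> C \<longleftrightarrow> w \<in> C"
    using undirected_tree_bridge[OF T z(1)] by blast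
  let ?g = "swap_colors C f"
  have g: "is_2RiDF ?D ?g" "weight T ?g = weight T f"
    using swap_colors_2RiDF[OF pair_graph_delete_edge[OF G] fD C(3)] by simp_all
  have gx: "?g x = 0" using x0 by (simp add: swap_colors_def)
  \<comment> \<open>The edge \<open>xy\<close> survives in \<open>?D\<close>, so \<open>y\<close>
    lies on the side of \<open>x\<close> and keeps its color, while \<open>z\<close> acquires that
    color.\<close>
  have "y \<notin> C" using C(2) C(3)[of x y] xy zy v(4) by auto
  then have gy: "?g y = f y" by (simp add: swap_colors_def)
  have gz: "?g z = f y" using C(1) z(2) fy by (auto simp: swap_colors_def)
  have gT: "is_2RiDF T ?g" by (rule is_2RiDF_insert_edge[OF G g(1)]) (rule gx)
  have "is_2RiDF (delete_edge T x y) ?g"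
    by (rule is_2RiDF_delete_edge[OF G gT]) (use gx gy gz zy z(1) y0 in auto)
  moreover have "is_gamma_ri2_function T ?g"
    using gT g(2) f by (simp add: is_gamma_ri2_function_def)
  ultimately show ?thesis by blast
qed

text \<open>Without the edge \<open>xy\<close>, the vertex \<open>x\<close> still has neighbors of
  both colors; these differ from \<open>y\<close>, which is the third colored neighbor in
  \<open>G\<close>.\<close>

lemma three_le_card_colored_neighbors:
  assumes G: "pair_graph G" and xy: "(x, y) \<in> parcs G"
    and f: "is_2RiDF (delete_edge G x y) f" and x0: "f x = 0" and y: "f y \<in> {1, 2}"
  shows "3 \<le> card (neighbors G x \<inter> (color_class G f 1 \<union> color_class G f 2))"
proof -
  let ?N = "neighbors G x \<inter> (color_class G f 1 \<union> color_class G f 2)"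
  note f' = f[unfolded is_2RiDF_iff[OF pair_graph_delete_edge[OF G]]]
  note v = pair_graph_arcD[OF G]
  obtain a where a: "(x, a) \<in> parcs (delete_edge G x y)" "f a = 1"
    using f' v(1)[OF xy] x0 by fastforce
  obtain b where b: "(x, b) \<in> parcs (delete_edge G x y)" "f b = 2"
    using f' v(1)[OF xy] x0 by fastforce
  have "card {y, a, b} = 3" using a b by (auto simp: card_insert_if)
  moreover have "{y, a, b} \<subseteq> ?N"
    using a b xy y v(2)[of x] by (auto simp: neighbors_def color_class_def)
  moreover have "finite ?N"
    using pair_graph_finite_pverts[OF G] by (simp add: color_class_def)
  ultimately show ?thesis by (metis card_mono)
qed

section \<open>The bounds and the characterization of equality in the upper one\<close>

theorem proposition23:
  fixes T :: "'a pair_pre_digraph" and x y :: 'a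
  assumes "undirected_tree T"
    and "(x, y) \<in> parcs T"
  shows "(gamma_ri2 T \<le> gamma_ri2 (delete_edge T x y) \<and>
          gamma_ri2 (delete_edge T x y) \<le> gamma_ri2 T + 1) \<and>
         (gamma_ri2 (delete_edge T x y) = gamma_ri2 T + 1 \<longleftrightarrow>
          (\<forall>f. is_gamma_ri2_function T f \<longrightarrow>
             (x \<in> color_class T f 0 \<longleftrightarrow> y \<notin> color_class T f 0) \<and>
             (\<forall>u \<in> {x, y} \<inter> color_class T f 0.
                card (neighbors T u \<inter> (color_class T f 1 \<union> color_class T f 2)) = 2)))"
proof -
  let ?D = "delete_edge T x y"
  let ?N = "\<lambda>f u. neighbors T u \<inter> (color_class T f 1 \<union> color_class T f 2)"
  let ?P = "\<lambda>f. (x \<in> color_class T f 0 \<longleftrightarrow> y \<notin> color_class T f 0) \<and>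
             (\<forall>u \<in> {x, y} \<inter> color_class T f 0. card (?N f u) = 2)"
  have G: "pair_graph T" using assms(1) by (simp add: undirected_tree_def)
  note D = pair_graph_delete_edge[OF G]
  note v = pair_graph_arcD[OF G assms(2)]
  have cc: "x \<in> color_class T f 0 \<longleftrightarrow> f x = 0" "y \<in> color_class T f 0 \<longleftrightarrow> f y = 0" for f
    using v by (auto simp: color_class_def)
  have P: "?P f \<longleftrightarrow> f x = 0 \<and> f y \<noteq> 0 \<and> card (?N f x) = 2 \<or>
      f y = 0 \<and> f x \<noteq> 0 \<and> card (?N f y) = 2" for f
    using cc[of f] by auto
  obtain h where h: "is_2RiDF ?D h" "weight T h = gamma_ri2 ?D"
    using ex_gamma_ri2_function[OF D] by (auto simp: is_gamma_ri2_function_def)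
  obtain g where g: "is_2RiDF ?D g" "is_2RiDF T g" "weight T g = gamma_ri2 ?D"
    using ex_common_2RiDF[OF assms h(1)] h(2) by auto
  have lower: "gamma_ri2 T \<le> gamma_ri2 ?D" using gamma_ri2_le[OF g(2)] g(3) by simp
  have upper: "gamma_ri2 ?D \<le> gamma_ri2 T + 1" by (rule gamma_ri2_delete_edge_le[OF G assms(2)])
  \<comment> \<open>The forward direction of (ii) by contraposition: some minimum 2RiDF of
    \<open>T\<close> survives the deletion, so the weight does not rise.\<close>
  have eq: "gamma_ri2 ?D = gamma_ri2 T" if f: "is_gamma_ri2_function T f" "\<not> ?P f" for f
  proof -
    have "\<exists>g. is_gamma_ri2_function T g \<and> is_2RiDF ?D g"
    proof -
      consider "f x = 0 \<longleftrightarrow> f y = 0" | "f x = 0" "f y \<noteq> 0" "card (?N f x) \<noteq> 2"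
        | "f y = 0" "f x \<noteq> 0" "card (?N f y) \<noteq> 2"
        using f(2) unfolding P by blast
      then show ?thesis
      proof cases
        \<comment> \<open>With both ends of color 0 or both colored, the edge \<open>xy\<close>
          dominates nothing.\<close>
        case 1
        have "is_2RiDF ?D f"
          by (rule is_2RiDF_delete_edge[OF G])
            (use 1 f(1) in \<open>auto simp: is_gamma_ri2_function_def\<close>)
        then show ?thesis using f(1) by blast
      next
        case 2
        then show ?thesis by (rule ex_gamma_ri2_function_delete_edge[OF assms f(1)])
      next
        case 3
        then have "\<exists>g. is_gamma_ri2_function T g \<and> is_2RiDF (delete_edge T y x) g"
          by (rule ex_gamma_ri2_function_delete_edge[OF assms(1) v(3) f(1)])
        then show ?thesis by (simp only: delete_edge_commute[of T y x])
      qed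
    qed
    then obtain k where "is_gamma_ri2_function T k" "is_2RiDF ?D k" by blast
    then have "gamma_ri2 ?D \<le> gamma_ri2 T"
      using gamma_ri2_le[of ?D k] by (simp add: is_gamma_ri2_function_def)
    with lower show ?thesis by simp
  qed
  have ex: "\<exists>f. is_gamma_ri2_function T f \<and> \<not> ?P f" if e: "gamma_ri2 ?D \<noteq> gamma_ri2 T + 1"
  proof -
    \<comment> \<open>By the two bounds the minimum weights now agree, so the common 2RiDF
      \<open>g\<close> is minimum on \<open>T\<close> as well; an end of color 0 opposite a colored
      one has at least 3 colored neighbors.\<close>
    have gT: "is_gamma_ri2_function T g"
      using g lower upper e by (simp add: is_gamma_ri2_function_def)
    have "g x \<in> {0, 1, 2}" "g y \<in> {0, 1, 2}"
      using g(2) v(1,2) unfolding is_2RiDF_iff[OF G] by blast+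
    then have "card (?N g x) \<noteq> 2" if "g x = 0" "g y \<noteq> 0"
      using three_le_card_colored_neighbors[OF G assms(2) g(1)] that by fastforce
    moreover have "card (?N g y) \<noteq> 2" if "g y = 0" "g x \<noteq> 0"
      using three_le_card_colored_neighbors[OF G v(3), of g] g(1) that \<open>g x \<in> {0, 1, 2}\<close>
      unfolding delete_edge_commute[of T y x] by fastforce
    ultimately have "\<not> ?P g" unfolding P by meson
    with gT show ?thesis by (intro exI[of _ g] conjI)
  qed
  have "gamma_ri2 ?D = gamma_ri2 T + 1 \<longleftrightarrow> (\<forall>f. is_gamma_ri2_function T f \<longrightarrow> ?P f)"
  proof
    assume e: "gamma_ri2 ?D = gamma_ri2 T + 1"
    show "\<forall>f. is_gamma_ri2_function T f \<longrightarrow> ?P f"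
    proof (intro allI impI)
      fix f assume f: "is_gamma_ri2_function T f"
      show "?P f"
      proof (rule ccontr)
        assume "\<not> ?P f"
        from eq[OF f this] e show False by simp
      qed
    qed
  next
    assume a: "\<forall>f. is_gamma_ri2_function T f \<longrightarrow> ?P f"
    show "gamma_ri2 ?D = gamma_ri2 T + 1"
    proof (rule ccontr)
      assume "gamma_ri2 ?D \<noteq> gamma_ri2 T + 1"
      then obtain f where "is_gamma_ri2_function T f" "\<not> ?P f" using ex by metis
      with a show False by metis
    qed
  qed
  with lower upper show ?thesis by (intro conjI)
qed

end
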